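(* $\mathbf{mCi}$ is not axiomatizable by a finite Set-Fmla H-system: there is no Set-Fmla H-system $\mathcal{H}$ with finitely many rule schemas such that $\vdash_{\mathcal{H}}\;=\;\vdash_{\mathbf{mCi}}$.
   Context: Let $\Sigma$ be the propositional signature with unary connectives $\neg,\circ$ and binary connectives $\land,\lor,\to$, and let $L$ be the set of $\Sigma$-formulas over a denumerable set $P$ of propositional variables. A (schematic) Set-Fmla Hilbert-style system is a collection of rule schemas $\Gamma/\varphi$ (with finite $\Gamma$; axioms have $\Gamma=\varnothing$), each rule consisting of all substitution instances of its schema; $\Gamma \vdash_{\mathcal{H}} \varphi$ holds iff there is a finite sequence of formulas ending in $\varphi$ each of which belongs to $\Gamma$ or is the conclusion of a rule instance whose premises occur earlier. Fix a Set-Fmla H-system for positive classical logic (the $\{\land,\lor,\to\}$-fragment of classical logic). For $j\in\omega$, $\neg^j$ denotes $j$-fold application of $\neg$. The logic $\mathbf{mCi}$ is the consequence relation $\vdash_{\mathbf{mCi}}$ of the system extending the positive classical system with the axiom schemas (Ax10) $p\lor\neg p$; (bc1) $\circ p\to(p\to(\neg p\to q))$; (ci) $\neg\circ p\to(p\land\neg p)$; and (cc)$_j$ $\circ\neg^j\circ p$ for every $j\in\omega$. *)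

theory Defs
  imports "HOL-Library.FSet"
begin

datatype fm =
    Var nat
  | Neg fm
  | Circ fm
  | Con fm fm
  | Dis fm fm
  | Imp fm fm

primrec subst :: "(nat \<Rightarrow> fm) \<Rightarrow> fm \<Rightarrow> fm" where
  "subst \<sigma> (Var n) = \<sigma> n"
| "subst \<sigma> (Neg a) = Neg (subst \<sigma> a)"
| "subst \<sigma> (Circ a) = Circ (subst \<sigma> a)"
| "subst \<sigma> (Con a b) = Con (subst \<sigma> a) (subst \<sigma> b)"
| "subst \<sigma> (Dis a b) = Dis (subst \<sigma> a) (subst \<sigma> b)"
| "subst \<sigma> (Imp a b) = Imp (subst \<sigma> a) (subst \<sigma> b)"

type_synonym schema = "fm fset \<times> fm"

definition is_derivation :: "schema set \<Rightarrow> fm set \<Rightarrow> fm list \<Rightarrow> bool" where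
  "is_derivation H \<Gamma> ds \<longleftrightarrow>
     (\<forall>i < length ds. ds ! i \<in> \<Gamma> \<or>
        (\<exists>(\<Delta>, \<psi>) \<in> H. \<exists>\<sigma>. ds ! i = subst \<sigma> \<psi> \<and>
           (\<forall>\<delta>. \<delta> |\<in>| \<Delta> \<longrightarrow> (\<exists>j < i. ds ! j = subst \<sigma> \<delta>))))"

definition derives :: "schema set \<Rightarrow> fm set \<Rightarrow> fm \<Rightarrow> bool" where
  "derives H \<Gamma> \<phi> \<longleftrightarrow> (\<exists>ds. ds \<noteq> [] \<and> last ds = \<phi> \<and> is_derivation H \<Gamma> ds)"

primrec positive :: "fm \<Rightarrow> bool" where
  "positive (Var n) \<longleftrightarrow> True"
| "positive (Neg a) \<longleftrightarrow> False"
| "positive (Circ a) \<longleftrightarrow> False"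
| "positive (Con a b) \<longleftrightarrow> positive a \<and> positive b"
| "positive (Dis a b) \<longleftrightarrow> positive a \<and> positive b"
| "positive (Imp a b) \<longleftrightarrow> positive a \<and> positive b"

text \<open>
  Two-valued valuations that are classical for the positive connectives.  They are arbitrary on
  formulas headed by \<open>Neg\<close> or \<open>Circ\<close>, but only positive formulas are evaluated below.
\<close>

definition classical_valuation :: "(fm \<Rightarrow> bool) \<Rightarrow> bool" where
  "classical_valuation v \<longleftrightarrow>
     (\<forall>a b. (v (Con a b) \<longleftrightarrow> v a \<and> v b) \<and>
            (v (Dis a b) \<longleftrightarrow> v a \<or> v b) \<and>
            (v (Imp a b) \<longleftrightarrow> (v a \<longrightarrow> v b)))"

definition classical_entails :: "fm set \<Rightarrow> fm \<Rightarrow> bool" where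
  "classical_entails \<Gamma> \<phi> \<longleftrightarrow>
     (\<forall>v. classical_valuation v \<longrightarrow> (\<forall>\<gamma> \<in> \<Gamma>. v \<gamma>) \<longrightarrow> v \<phi>)"

text \<open>
  \<open>Hp\<close> is a system in the language of the positive connectives that axiomatizes the positive
  fragment of classical logic.  Derivations may pass through non-positive instances of its schemas;
  between positive formulas this adds nothing, since replacing all maximal subformulas headed by
  \<open>Neg\<close> or \<open>Circ\<close> by a fixed variable turns any derivation into one consisting of positive formulas.
\<close>

definition positive_classical_system :: "schema set \<Rightarrow> bool" where
  "positive_classical_system Hp \<longleftrightarrow>
     (\<forall>(\<Delta>, \<psi>) \<in> Hp. (\<forall>\<delta>. \<delta> |\<in>| \<Delta> \<longrightarrow> positive \<delta>) \<and> positive \<psi>) \<and>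
     (\<forall>\<Gamma> \<phi>. (\<forall>\<gamma> \<in> \<Gamma>. positive \<gamma>) \<longrightarrow> positive \<phi> \<longrightarrow>
        (derives Hp \<Gamma> \<phi> \<longleftrightarrow> classical_entails \<Gamma> \<phi>))"

definition ax10 :: fm where
  "ax10 = Dis (Var 0) (Neg (Var 0))"

definition bc1 :: fm where
  "bc1 = Imp (Circ (Var 0)) (Imp (Var 0) (Imp (Neg (Var 0)) (Var 1)))"

definition ci :: fm where
  "ci = Imp (Neg (Circ (Var 0))) (Con (Var 0) (Neg (Var 0)))"

definition cc :: "nat \<Rightarrow> fm" where
  "cc j = Circ ((Neg ^^ j) (Circ (Var 0)))"

text \<open>
  The system for mCi over the positive classical system \<open>Hp\<close>.  Its consequence relation does not
  depend on the choice of \<open>Hp\<close>: two such systems derive each other's schemas.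
\<close>

definition mCi_system :: "schema set \<Rightarrow> schema set" where
  "mCi_system Hp = Hp \<union> (\<lambda>\<alpha>. ({||}, \<alpha>)) ` ({ax10, bc1, ci} \<union> range cc)"

end

(* By compactness, the rules of a finite system for mCi are derivable in mCi without (cc)_N for
   some even N > 0.  A valuation that makes both X = Neg^N (Circ p) and its negation true, and
   treats every formula other than X as consistent, validates that weaker system but refutes
   Circ X, which is the instance (cc)_N. *)
theory Submission imports Defs begin

text \<open>Valuations are arbitrary sets of true formulas, not determined by their values at
  variables, so every substitution instance of a rule is checked against one fixed
  \<open>v\<close>.\<close>

definition validates :: "(fm \<Rightarrow> bool) \<Rightarrow> schema set \<Rightarrow> bool" where
  "validates v H \<longleftrightarrow>
     (\<forall>(\<Delta>, \<psi>) \<in> H. \<forall>\<sigma>. (\<forall>\<delta>. \<delta> |\<in>| \<Delta> \<longrightarrow> v (subst \<sigma> \<delta>)) \<longrightarrow> v (subst \<sigma> \<psi>))"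

lemma validatesI:
  assumes "\<And>\<Delta> \<psi> \<sigma>. (\<Delta>, \<psi>) \<in> H \<Longrightarrow> \<forall>\<delta>. \<delta> |\<in>| \<Delta> \<longrightarrow> v (subst \<sigma> \<delta>) \<Longrightarrow> v (subst \<sigma> \<psi>)"
  shows "validates v H"
  using assms unfolding validates_def by blast

lemma validatesD:
  assumes "validates v H" "(\<Delta>, \<psi>) \<in> H" "\<And>\<delta>. \<delta> |\<in>| \<Delta> \<Longrightarrow> v (subst \<sigma> \<delta>)"
  shows "v (subst \<sigma> \<psi>)"
  using assms unfolding validates_def by blast

lemma validates_subset: "validates v H \<Longrightarrow> G \<subseteq> H \<Longrightarrow> validates v G"
  unfolding validates_def by blast

lemma subst_subst: "subst \<sigma> (subst \<tau> \<phi>) = subst (\<lambda>n. subst \<sigma> (\<tau> n)) \<phi>"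
  by (induction \<phi>) auto

lemma subst_Var: "subst Var \<phi> = \<phi>"
  by (induction \<phi>) auto

lemma subst_Neg_funpow: "subst \<sigma> ((Neg ^^ j) \<phi>) = (Neg ^^ j) (subst \<sigma> \<phi>)"
  by (induction j) auto

text \<open>An instance of an instance is again an instance. Pulling \<open>v\<close> back along
  \<open>\<sigma>\<close> reduces the validity of an instance of a rule to that of the schema
  itself.\<close>

lemma validates_subst:
  assumes "validates v H"
  shows "validates (\<lambda>\<phi>. v (subst \<sigma> \<phi>)) H"
proof (rule validatesI)
  fix \<Delta> \<psi> \<tau>
  assume "(\<Delta>, \<psi>) \<in> H" "\<forall>\<delta>. \<delta> |\<in>| \<Delta> \<longrightarrow> v (subst \<sigma> (subst \<tau> \<delta>))"
  then show "v (subst \<sigma> (subst \<tau> \<psi>))"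
    unfolding subst_subst using assms by (blast intro: validatesD)
qed

lemma derives_sound:
  assumes "validates v H" "derives H \<Gamma> \<phi>" "\<And>\<gamma>. \<gamma> \<in> \<Gamma> \<Longrightarrow> v \<gamma>"
  shows "v \<phi>"
proof -
  obtain ds where ds: "ds \<noteq> []" "last ds = \<phi>" "is_derivation H \<Gamma> ds"
    using assms(2) unfolding derives_def by blast
  have "v (ds ! i)" if "i < length ds" for i
    using that
  proof (induction i rule: less_induct)
    case (less i)
    consider "ds ! i \<in> \<Gamma>"
      | \<Delta> \<psi> \<sigma> where "(\<Delta>, \<psi>) \<in> H" "ds ! i = subst \<sigma> \<psi>"
          "\<forall>\<delta>. \<delta> |\<in>| \<Delta> \<longrightarrow> (\<exists>j < i. ds ! j = subst \<sigma> \<delta>)"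
      using ds(3) less.prems unfolding is_derivation_def by blast
    then show ?case
    proof cases
      case 1
      then show ?thesis by (rule assms(3))
    next
      case 2
      have "v (subst \<sigma> \<delta>)" if "\<delta> |\<in>| \<Delta>" for \<delta>
      proof -
        obtain j where "j < i" "ds ! j = subst \<sigma> \<delta>"
          using 2(3) \<open>\<delta> |\<in>| \<Delta>\<close> by blast
        with less.IH[of j] less.prems show ?thesis by simp
      qed
      then have "v (subst \<sigma> \<psi>)" by (rule validatesD[OF assms(1) 2(1)])
      with 2(2) show ?thesis by simp
    qed
  qed
  from this[of "length ds - 1"] show ?thesis using ds(1,2) by (simp add: last_conv_nth)
qed

text \<open>List the premises, then apply the rule under the identity substitution
  \<open>Var\<close>.\<close>

lemma derives_rule:
  assumes "(\<Delta>, \<psi>) \<in> H"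
  shows "derives H (fset \<Delta>) \<psi>"
proof -
  obtain xs where xs: "set xs = fset \<Delta>"
    using finite_list[OF finite_fset[of \<Delta>]] by (rule exE)
  have hyp: "(xs @ [\<psi>]) ! i \<in> fset \<Delta>" if "i < length xs" for i
    using that nth_mem[OF that] xs by (simp add: nth_append)
  have prem: "\<exists>j < length xs. (xs @ [\<psi>]) ! j = subst Var \<delta>" if "\<delta> |\<in>| \<Delta>" for \<delta>
  proof -
    obtain j where "j < length xs" "xs ! j = \<delta>"
      using \<open>\<delta> |\<in>| \<Delta>\<close> unfolding xs[symmetric] in_set_conv_nth by blast
    then show ?thesis by (auto simp: nth_append subst_Var)
  qed
  have "is_derivation H (fset \<Delta>) (xs @ [\<psi>])"
    unfolding is_derivation_def
  proof (intro allI impI)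
    fix i
    assume "i < length (xs @ [\<psi>])"
    then consider "i < length xs" | "i = length xs" by fastforce
    then show "(xs @ [\<psi>]) ! i \<in> fset \<Delta> \<or> (\<exists>(\<Delta>, \<psi>') \<in> H. \<exists>\<sigma>. (xs @ [\<psi>]) ! i = subst \<sigma> \<psi>' \<and>
        (\<forall>\<delta>. \<delta> |\<in>| \<Delta> \<longrightarrow> (\<exists>j < i. (xs @ [\<psi>]) ! j = subst \<sigma> \<delta>)))"
    proof cases
      case 1
      then show ?thesis using hyp by simp
    next
      case 2
      have "(xs @ [\<psi>]) ! i = subst Var \<psi> \<and> (\<forall>\<delta>. \<delta> |\<in>| \<Delta> \<longrightarrow> (\<exists>j < i. (xs @ [\<psi>]) ! j = subst Var \<delta>))"
        using prem by (simp add: 2 subst_Var)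
      with assms show ?thesis by blast
    qed
  qed
  then show ?thesis unfolding derives_def by (intro exI[of _ "xs @ [\<psi>]"]) simp
qed

text \<open>Compactness with respect to rules: a derivation has finitely many positions, and one
  rule for each of them suffices.\<close>

lemma derives_finite_subsystem:
  assumes "derives H \<Gamma> \<phi>"
  obtains G where "finite G" "G \<subseteq> H" "derives G \<Gamma> \<phi>"
proof -
  obtain ds where ds: "ds \<noteq> []" "last ds = \<phi>" "is_derivation H \<Gamma> ds"
    using assms unfolding derives_def by blast
  define P where "P i r \<longleftrightarrow> (case r of (\<Delta>, \<psi>) \<Rightarrow> \<exists>\<sigma>. ds ! i = subst \<sigma> \<psi> \<and>
      (\<forall>\<delta>. \<delta> |\<in>| \<Delta> \<longrightarrow> (\<exists>j < i. ds ! j = subst \<sigma> \<delta>)))" for i and r :: schema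
  have step: "is_derivation K \<Gamma> ds \<longleftrightarrow> (\<forall>i < length ds. ds ! i \<in> \<Gamma> \<or> (\<exists>r \<in> K. P i r))" for K
    unfolding is_derivation_def P_def by simp
  obtain f where f: "\<And>i. i < length ds \<Longrightarrow> ds ! i \<in> \<Gamma> \<or> f i \<in> H \<and> P i (f i)"
    using ds(3) unfolding step by metis
  \<comment> \<open>At a position justified by membership in \<open>\<Gamma>\<close>,
    \<open>f\<close> may take a value outside \<open>H\<close>; the intersection discards
    it.\<close>
  have "is_derivation (f ` {..<length ds} \<inter> H) \<Gamma> ds"
    unfolding step using f by blast
  with ds(1,2) have "derives (f ` {..<length ds} \<inter> H) \<Gamma> \<phi>"
    unfolding derives_def by blast
  then show ?thesis by (intro that) auto
qed

text \<open>Each of the finitely many rules needs only finitely many rules of \<open>K\<close>, and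
  \<open>G\<close> is the union of these. Soundness of \<open>G\<close> under the pulled-back
  valuation then validates each instance of a rule of \<open>H\<close>.\<close>

lemma finite_derivable_system:
  assumes "finite H" "\<And>\<Delta> \<psi>. (\<Delta>, \<psi>) \<in> H \<Longrightarrow> derives K (fset \<Delta>) \<psi>"
  obtains G where "finite G" "G \<subseteq> K" "\<And>v. validates v G \<Longrightarrow> validates v H"
proof -
  have "\<forall>r \<in> H. \<exists>G. finite G \<and> G \<subseteq> K \<and> derives G (fset (fst r)) (snd r)"
    using assms(2) derives_finite_subsystem by (metis prod.collapse)
  then obtain g where g: "\<And>r. r \<in> H \<Longrightarrow> finite (g r) \<and> g r \<subseteq> K \<and> derives (g r) (fset (fst r)) (snd r)"
    by metis
  have "validates v H" if v: "validates v (\<Union> (g ` H))" for v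
  proof (rule validatesI)
    fix \<Delta> \<psi> \<sigma>
    assume r: "(\<Delta>, \<psi>) \<in> H" and prems: "\<forall>\<delta>. \<delta> |\<in>| \<Delta> \<longrightarrow> v (subst \<sigma> \<delta>)"
    have "validates v (g (\<Delta>, \<psi>))"
      using v by (rule validates_subset) (use r in blast)
    from derives_sound[OF validates_subst[OF this]] g[OF r] prems
    show "v (subst \<sigma> \<psi>)" by fastforce
  qed
  with g assms(1) show ?thesis by (intro that[of "\<Union> (g ` H)"]) auto
qed

text \<open>Nothing is known of the rules of \<open>Hp\<close> beyond what they derive. But each
  rule derives its own conclusion from its premises, all of them positive, so it is classically
  valid; and \<open>v\<close> composed with a substitution is again classical.\<close>

lemma classical_valuation_validates:
  assumes "positive_classical_system Hp" "classical_valuation v"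
  shows "validates v Hp"
proof (rule validatesI)
  fix \<Delta> \<psi> \<sigma>
  assume r: "(\<Delta>, \<psi>) \<in> Hp" and prems: "\<forall>\<delta>. \<delta> |\<in>| \<Delta> \<longrightarrow> v (subst \<sigma> \<delta>)"
  have "\<forall>\<gamma> \<in> fset \<Delta>. positive \<gamma>" "positive \<psi>"
    using assms(1) r unfolding positive_classical_system_def by auto
  with derives_rule[OF r] have "classical_entails (fset \<Delta>) \<psi>"
    using assms(1) unfolding positive_classical_system_def by simp
  moreover have "classical_valuation (\<lambda>\<phi>. v (subst \<sigma> \<phi>))"
    using assms(2) unfolding classical_valuation_def by simp
  ultimately show "v (subst \<sigma> \<psi>)"
    using prems unfolding classical_entails_def by (elim allE[of _ "\<lambda>\<phi>. v (subst \<sigma> \<phi>)"]) simp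
qed

text \<open>Negation is classical except at \<open>X\<close>, whose negation is always true, and
  \<open>X\<close> is the only formula not declared consistent.\<close>

primrec valuation :: "fm \<Rightarrow> fm \<Rightarrow> bool" where
  "valuation X (Var n) \<longleftrightarrow> False"
| "valuation X (Neg a) \<longleftrightarrow> \<not> valuation X a \<or> a = X"
| "valuation X (Circ a) \<longleftrightarrow> a \<noteq> X"
| "valuation X (Con a b) \<longleftrightarrow> valuation X a \<and> valuation X b"
| "valuation X (Dis a b) \<longleftrightarrow> valuation X a \<or> valuation X b"
| "valuation X (Imp a b) \<longleftrightarrow> (valuation X a \<longrightarrow> valuation X b)"

lemma classical_valuation_valuation: "classical_valuation (valuation X)"
  unfolding classical_valuation_def by simp

text \<open>The leading negations stop at \<open>Circ\<close>, so their number can be read off. This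
  keeps the schemas \<open>cc j\<close> apart, even up to substitution instances.\<close>

lemma Neg_funpow_Circ_eq_iff: "(Neg ^^ i) (Circ a) = (Neg ^^ j) (Circ b) \<longleftrightarrow> i = j \<and> a = b"
proof (induction i arbitrary: j)
  case 0
  then show ?case by (cases j) auto
next
  case (Suc i)
  then show ?case by (cases j) auto
qed

lemma Circ_neq_Neg_funpow: "0 < n \<Longrightarrow> Circ a \<noteq> (Neg ^^ n) b"
  by (cases n) auto

text \<open>\<open>Circ (Var 0)\<close> is true, and each negation up to the \<open>n\<close>-th is
  applied to a formula other than \<open>X\<close>, so the values alternate.\<close>

lemma valuation_Neg_funpow:
  assumes X: "X = (Neg ^^ n) (Circ (Var 0))" and "0 < n" "i \<le> n"
  shows "valuation X ((Neg ^^ i) (Circ (Var 0))) \<longleftrightarrow> even i"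
  using assms(3)
proof (induction i)
  case 0
  then show ?case using assms(2) unfolding X by (cases n) auto
next
  case (Suc i)
  then have "(Neg ^^ i) (Circ (Var 0)) \<noteq> X" by (simp add: X Neg_funpow_Circ_eq_iff)
  with Suc show ?case by simp
qed

lemma valuation_validates_mCi_without_cc:
  assumes Hp: "positive_classical_system Hp" and n: "even n" "0 < n"
  shows "validates (valuation ((Neg ^^ n) (Circ (Var 0)))) (mCi_system Hp - {({||}, cc n)})"
proof (rule validatesI)
  define X where "X = (Neg ^^ n) (Circ (Var 0))"
  have X: "valuation X X"
    using valuation_Neg_funpow[OF X_def n(2) le_refl] n(1) by (simp flip: X_def)
  have Circ_neq_X: "Circ a \<noteq> X" for a
    unfolding X_def using n(2) by (rule Circ_neq_Neg_funpow)
  fix \<Delta> \<psi> \<sigma>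
  assume r: "(\<Delta>, \<psi>) \<in> mCi_system Hp - {({||}, cc n)}"
    and prems: "\<forall>\<delta>. \<delta> |\<in>| \<Delta> \<longrightarrow> valuation ((Neg ^^ n) (Circ (Var 0))) (subst \<sigma> \<delta>)"
  then consider "(\<Delta>, \<psi>) \<in> Hp" | "\<psi> = ax10" | "\<psi> = bc1" | "\<psi> = ci" | j where "\<psi> = cc j" "j \<noteq> n"
    unfolding mCi_system_def by blast
  then have "valuation X (subst \<sigma> \<psi>)"
  proof cases
    case 1
    from validatesD[OF classical_valuation_validates[OF Hp classical_valuation_valuation] this] prems
    show ?thesis unfolding X_def by blast
  next
    case 2
    then show ?thesis by (simp add: ax10_def)
  next
    case 3
    \<comment> \<open>If \<open>Circ a\<close> is true then \<open>a\<close> is not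
      \<open>X\<close>, so \<open>a\<close> and \<open>Neg a\<close> cannot both be true.\<close>
    then show ?thesis by (simp add: bc1_def)
  next
    case 4
    \<comment> \<open>As \<open>Circ a\<close> is not \<open>X\<close>, \<open>Neg (Circ a)\<close>
      is true only when \<open>Circ a\<close> is false, that is, when \<open>a\<close> is
      \<open>X\<close>. Then both conjuncts hold: \<open>X\<close> is true because \<open>n\<close>
      is even, and \<open>Neg X\<close> is true by definition.\<close>
    then show ?thesis using X Circ_neq_X by (auto simp: ci_def)
  next
    case 5
    \<comment> \<open>An instance of \<open>cc j\<close> is false only if the formula under its
      outer \<open>Circ\<close> is \<open>X\<close>, which would force \<open>j = n\<close>.\<close>
    then show ?thesis by (simp add: cc_def subst_Neg_funpow X_def Neg_funpow_Circ_eq_iff)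
  qed
  then show "valuation ((Neg ^^ n) (Circ (Var 0))) (subst \<sigma> \<psi>)" by (simp add: X_def)
qed

lemma ex_even_cc_notin:
  assumes "finite (G :: schema set)"
  obtains n where "even n" "0 < n" "({||}, cc n) \<notin> G"
proof -
  \<comment> \<open>The numbers \<open>2 * Suc k\<close> are the positive even ones, and they index
    pairwise distinct axioms.\<close>
  have "inj (\<lambda>k. ({||} :: fm fset, cc (2 * Suc k)))"
    by (auto intro!: injI simp: cc_def Neg_funpow_Circ_eq_iff simp del: funpow.simps)
  then have "infinite (range (\<lambda>k. ({||} :: fm fset, cc (2 * Suc k))))"
    using finite_imageD infinite_UNIV_nat by blast
  then have "\<not> range (\<lambda>k. ({||} :: fm fset, cc (2 * Suc k))) \<subseteq> G"
    using assms finite_subset by blast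
  then obtain k where "({||}, cc (2 * Suc k)) \<notin> G" by blast
  then show ?thesis by (intro that[of "2 * Suc k"]) auto
qed

theorem theorem2:
  fixes Hp :: "schema set"
  assumes "positive_classical_system Hp"
  shows "\<not> (\<exists>H :: schema set. finite H \<and>
           (\<forall>\<Gamma> \<phi>. derives H \<Gamma> \<phi> \<longleftrightarrow> derives (mCi_system Hp) \<Gamma> \<phi>))"
proof
  assume "\<exists>H :: schema set. finite H \<and>
           (\<forall>\<Gamma> \<phi>. derives H \<Gamma> \<phi> \<longleftrightarrow> derives (mCi_system Hp) \<Gamma> \<phi>)"
  then obtain H :: "schema set" where "finite H"
    and H: "\<And>\<Gamma> \<phi>. derives H \<Gamma> \<phi> \<longleftrightarrow> derives (mCi_system Hp) \<Gamma> \<phi>"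
    by blast
  have "derives (mCi_system Hp) (fset \<Delta>) \<psi>" if "(\<Delta>, \<psi>) \<in> H" for \<Delta> \<psi>
    using derives_rule[OF that] H by simp
  then obtain G where G: "finite G" "G \<subseteq> mCi_system Hp" "\<And>v. validates v G \<Longrightarrow> validates v H"
    using finite_derivable_system[OF \<open>finite H\<close>] by blast
  obtain n where n: "even n" "0 < n" "({||}, cc n) \<notin> G"
    using ex_even_cc_notin[OF G(1)] .
  define X where "X = (Neg ^^ n) (Circ (Var 0))"
  have "validates (valuation X) G"
    unfolding X_def
    by (rule validates_subset[OF valuation_validates_mCi_without_cc[OF assms n(1,2)]])
      (use G(2) n(3) in blast)
  then have "validates (valuation X) H" by (rule G(3))
  moreover have "({||}, cc n) \<in> mCi_system Hp" unfolding mCi_system_def by blast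
  then have "derives H {} (cc n)" using derives_rule H by fastforce
  ultimately have "valuation X (cc n)" by (rule derives_sound) simp
  \<comment> \<open>The schema \<open>cc n\<close>, taken without substitution, is
    \<open>Circ X\<close> itself, which the valuation makes false.\<close>
  then show False by (simp add: cc_def X_def)
qed

end
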